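(* Let $d\ge 2$, let $\lambda_1,\dots,\lambda_d\in\mathbb C$, and let $D=\operatorname{diag}(\lambda_1,\dots,\lambda_d)\in\mathcal B(\mathbb C^d)$, where $\mathbb C^d$ carries its Hilbert space (Euclidean) norm. Then: (i) $D$ is numerically hypercyclic if and only if $G_D\ne\varnothing$; (ii) $D$ is topologically numerically transitive if and only if $G_D$ is dense in $\Delta_d$.
   Context: $\Delta_d:=\{a=(a_1,\dots,a_d)\in[0,1]^d:\sum_{j=1}^d a_j=1\}$ is the standard simplex with its usual topology. For $a\in\Delta_d$, $\mathcal O_D(a):=\{1\}\cup\{\sum_{j=1}^d a_j\lambda_j^n: n\ge 1\}$, and $G_D:=\{a\in\Delta_d:\mathcal O_D(a)\text{ is dense in }\mathbb C\}$. For a complex Banach space $X$ with unit spheres $S_X$, $S_{X^*}$, $\Pi(X):=\{(x,x^* )\in S_X\times S_{X^*}:x^*(x)=1\}$ with the topology induced by the norm $\max\{\|x\|,\|x^*\|\}$. An operator $T\in\mathcal B(X)$ is numerically hypercyclic if there is $(x,x^* )\in\Pi(X)$ such that $\{x^*(T^nx):n\ge 0\}$ is dense in $\mathbb C$. It is topologically numerically transitive if for every nonempty open $U\subset\Pi(X)$ and nonempty open $V\subset\mathbb C$ there exist $n\ge 0$ and $(x,x^* )\in U$ with $x^*(T^nx)\in V$. *)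

theory Defs
  imports "HOL-Analysis.Analysis"
begin

text \<open>
  The library has only real normed spaces. A complex Banach space is rendered as a real Banach
  space with a complex scalar multiplication that extends the real one and is compatible
  with the norm.
\<close>

locale complex_banach = vector_space scale
  for scale :: "complex \<Rightarrow> 'a::banach \<Rightarrow> 'a" +
  assumes scale_of_real: "scale (of_real r) x = r *\<^sub>R x"
    and norm_scale: "norm (scale c x) = cmod c * norm x"
begin

text \<open>
  Functionals are real-linear bounded maps into \<^typ>\<open>complex\<close> that commute with complex scalars;
  the norm of \<open>'a \<Rightarrow>\<^sub>L complex\<close> is the operator norm.
\<close>

definition dual :: "('a \<Rightarrow>\<^sub>L complex) set" where
  "dual = {f. \<forall>c x. blinfun_apply f (scale c x) = c * blinfun_apply f x}"

definition norming_pairs :: "('a \<times> ('a \<Rightarrow>\<^sub>L complex)) set" where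
  "norming_pairs = {(x, f). norm x = 1 \<and> f \<in> dual \<and> norm f = 1 \<and> blinfun_apply f x = 1}"

definition numerically_hypercyclic :: "('a \<Rightarrow> 'a) \<Rightarrow> bool" where
  "numerically_hypercyclic T \<longleftrightarrow>
     (\<exists>(x, f) \<in> norming_pairs. closure {blinfun_apply f ((T ^^ n) x) | n. True} = UNIV)"

text \<open>
  The product topology on pairs is the one induced by the maximum norm, see
  \<open>openin_prod_iff_max_norm\<close> below.
\<close>

definition topologically_numerically_transitive :: "('a \<Rightarrow> 'a) \<Rightarrow> bool" where
  "topologically_numerically_transitive T \<longleftrightarrow>
     (\<forall>U V. openin (top_of_set norming_pairs) U \<and> U \<noteq> {} \<and> open V \<and> V \<noteq> {} \<longrightarrow>
        (\<exists>n. \<exists>(x, f) \<in> U. blinfun_apply f ((T ^^ n) x) \<in> V))"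

end

lemma openin_prod_iff_max_norm:
  fixes S U :: "('a::real_normed_vector \<times> 'b::real_normed_vector) set"
  shows "openin (top_of_set S) U \<longleftrightarrow> U \<subseteq> S \<and>
    (\<forall>p\<in>U. \<exists>e>0. \<forall>q\<in>S. max (norm (fst q - fst p)) (norm (snd q - snd p)) < e \<longrightarrow> q \<in> U)"
proof -
  have le: "max (norm (fst q - fst p)) (norm (snd q - snd p)) \<le> dist q p" for p q :: "'a \<times> 'b"
    using dist_fst_le[of q p] dist_snd_le[of q p] by (simp add: dist_norm)
  have lt: "dist q p < e" if "max (norm (fst q - fst p)) (norm (snd q - snd p)) < e / 2"
    for p q :: "'a \<times> 'b" and e
  proof -
    have "dist q p \<le> dist (fst q) (fst p) + dist (snd q) (snd p)"
      by (simp add: dist_prod_def sqrt_sum_squares_le_sum)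
    then show ?thesis using that by (simp add: dist_norm)
  qed
  have "(\<exists>e>0. \<forall>q\<in>S. dist q p < e \<longrightarrow> q \<in> U) \<longleftrightarrow>
    (\<exists>e>0. \<forall>q\<in>S. max (norm (fst q - fst p)) (norm (snd q - snd p)) < e \<longrightarrow> q \<in> U)"
    (is "?L \<longleftrightarrow> ?R") for p
  proof
    assume ?L
    then obtain e where "e > 0" "\<forall>q\<in>S. dist q p < e \<longrightarrow> q \<in> U" by blast
    then show ?R using lt by (intro exI[of _ "e / 2"]) auto
  next
    assume ?R
    then show ?L using le by (meson le_less_trans)
  qed
  then show ?thesis by (simp add: openin_euclidean_subtopology_iff)
qed

lemma complex_banach_vec:
  "complex_banach ((*s) :: complex \<Rightarrow> complex^'n \<Rightarrow> complex^'n)"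
proof unfold_locales
  fix r :: real and x :: "complex^'n" and c :: complex
  show "complex_of_real r *s x = r *\<^sub>R x"
    by (simp add: vec_eq_iff scaleR_conv_of_real[where 'a = complex])
  show "norm (c *s x) = cmod c * norm x"
    by (simp add: norm_vec_def norm_mult L2_set_right_distrib)
qed

definition diag :: "complex^'n \<Rightarrow> complex^'n^'n" where
  "diag l = (\<chi> i j. if i = j then l $ i else 0)"

definition std_simplex :: "(real^'n) set" where
  "std_simplex = {a. (\<forall>j. a $ j \<in> {0..1}) \<and> (\<Sum>j\<in>UNIV. a $ j) = 1}"

text \<open>In the next two definitions \<open>l\<close> is the diagonal of \<open>D\<close>.\<close>

definition simplex_orbit :: "complex^'n \<Rightarrow> real^'n \<Rightarrow> complex set" where
  "simplex_orbit l a = {1} \<union> {\<Sum>j\<in>UNIV. of_real (a $ j) * (l $ j) ^ n | n. n \<ge> 1}"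

definition dense_orbit_params :: "complex^'n \<Rightarrow> (real^'n) set" where
  "dense_orbit_params l = {a \<in> std_simplex. closure (simplex_orbit l a) = UNIV}"

end

theory Submission
  imports Defs
begin

text \<open>
  In Euclidean space the equality case of Cauchy-Schwarz forces a norming functional of a unit
  vector \<open>x\<close> to be \<open>y \<mapsto> \<langle>y, x\<rangle>\<close>. Hence the numerical orbit of \<open>D\<close> at \<open>x\<close> depends only on the point
  \<open>a = (|x\<^sub>j|\<^sup>2)\<^sub>j\<close> of the simplex and coincides with the orbit of \<open>a\<close>, which gives (i). The map
  \<open>x \<mapsto> a\<close> is continuous, and keeping the phases of \<open>x\<close> while varying the moduli gives
  continuous local sections of it, so transitivity transfers to the simplex; there it is
  equivalent to density of \<open>G\<^sub>D\<close> by Baire's theorem.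
\<close>

section \<open>Norming functionals of Euclidean space\<close>

text \<open>The conjugate falls on \<open>x\<close>, so each \<open>riesz x\<close> is complex
  linear in its argument.\<close>

lift_definition riesz :: "complex^'n \<Rightarrow> (complex^'n) \<Rightarrow>\<^sub>L complex" is
  "\<lambda>x y. \<Sum>j\<in>UNIV. cnj (x $ j) * y $ j"
  by (intro bounded_linear_sum bounded_linear_mult_right[THEN bounded_linear_compose]
      bounded_linear_vec_nth)

lemma norm_riesz_le:
  fixes x :: "complex^'n"
  shows "norm (riesz x) \<le> norm x"
proof (rule norm_blinfun_bound)
  fix y :: "complex^'n"
  have "norm (riesz x y) \<le> (\<Sum>j\<in>UNIV. \<bar>cmod (x $ j)\<bar> * \<bar>cmod (y $ j)\<bar>)"
    unfolding riesz.rep_eq by (rule sum_norm_le) (simp add: norm_mult)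
  also have "\<dots> \<le> norm x * norm y"
    unfolding norm_vec_def by (rule L2_set_mult_ineq)
  finally show "norm (riesz x y) \<le> norm x * norm y" .
qed simp

lemma riesz_diff: "riesz x - riesz y = riesz (x - y)"
  by (rule blinfun_eqI)
    (simp add: minus_blinfun.rep_eq riesz.rep_eq algebra_simps sum_subtractf)

text \<open>In the operator norm \<open>riesz\<close> is additive and 1-Lipschitz, so a pair
  \<open>(x, riesz x)\<close> varies continuously with \<open>x\<close> alone.\<close>

lemma continuous_on_riesz: "continuous_on S riesz"
proof (rule lipschitz_on_continuous_on)
  show "1-lipschitz_on S riesz"
    by (rule lipschitz_onI) (simp_all add: dist_norm riesz_diff norm_riesz_le)
qed

lemma power2_norm_vec: "(norm x)\<^sup>2 = (\<Sum>j\<in>UNIV. (norm (x $ j))\<^sup>2)"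
  unfolding norm_vec_def L2_set_def by (simp add: sum_nonneg)

lemma riesz_self: "riesz x x = of_real ((norm x)\<^sup>2)"
  by (simp add: riesz.rep_eq power2_norm_vec complex_norm_square mult.commute del: of_real_power)

lemma Re_riesz: "Re (riesz x y) = x \<bullet> y"
  by (simp add: riesz.rep_eq inner_vec_def inner_complex_def)

lemma riesz_in_dual: "riesz x \<in> complex_banach.dual (*s)"
  by (simp add: complex_banach.dual_def[OF complex_banach_vec] riesz.rep_eq
      sum_distrib_left mult.left_commute)

text \<open>A complex-linear functional is determined by its values on the standard basis;
  conjugating them cancels the conjugate built into \<open>riesz\<close>.\<close>

lemma dual_eq_riesz:
  fixes f :: "(complex^'n) \<Rightarrow>\<^sub>L complex"
  assumes "f \<in> complex_banach.dual (*s)"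
  obtains w where "f = riesz w"
proof
  show "f = riesz (\<chi> j. cnj (f (axis j 1)))"
  proof (rule blinfun_eqI)
    fix y :: "complex^'n"
    have "f y = f (\<Sum>j\<in>UNIV. y $ j *s axis j 1)"
      by (simp add: basis_expansion)
    also have "\<dots> = (\<Sum>j\<in>UNIV. y $ j * f (axis j 1))"
      using assms
      by (simp add: blinfun.sum_right complex_banach.dual_def[OF complex_banach_vec])
    finally show "f y = riesz (\<chi> j. cnj (f (axis j 1))) y"
      by (simp add: riesz.rep_eq mult.commute)
  qed
qed

lemma norming_pairs_eq:
  "complex_banach.norming_pairs (*s) = {(x :: complex^'n, riesz x) | x. norm x = 1}"
proof (intro set_eqI iffI)
  fix p :: "(complex^'n) \<times> ((complex^'n) \<Rightarrow>\<^sub>L complex)"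
  assume "p \<in> complex_banach.norming_pairs (*s)"
  then obtain x f where p: "p = (x, f)" and x: "norm x = 1"
    and f: "f \<in> complex_banach.dual (*s)" "norm f = 1" "f x = 1"
    by (auto simp: complex_banach.norming_pairs_def[OF complex_banach_vec])
  obtain w where w: "f = riesz w"
    using f(1) by (rule dual_eq_riesz)
  \<comment> \<open>Testing \<open>f\<close> on its own representing vector gives
    \<open>(norm w)\<^sup>2 \<le> norm w\<close>.\<close>
  have "norm (riesz w w) \<le> norm w"
    using norm_blinfun[of f w] f(2) w by simp
  then have "norm w \<le> 1"
    by (cases "w = 0") (simp_all add: riesz_self power2_eq_square norm_mult)
  moreover have "w \<bullet> x = 1"
    using Re_riesz[of w x] f(3) w by simp
  \<comment> \<open>Expanding the square gives \<open>(norm w)\<^sup>2 - 2 * (w \<bullet> x) + (norm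
    x)\<^sup>2 \<le> 1 - 2 + 1\<close>.\<close>
  ultimately have "(norm (w - x))\<^sup>2 \<le> 0"
    using x power_le_one[of "norm w" 2]
    by (simp add: power2_norm_eq_inner inner_diff_left inner_diff_right inner_commute
        norm_eq_1)
  then have "w = x" by simp
  then show "p \<in> {(x, riesz x) | x. norm x = 1}"
    using p w x by blast
next
  fix p :: "(complex^'n) \<times> ((complex^'n) \<Rightarrow>\<^sub>L complex)"
  assume "p \<in> {(x, riesz x) | x. norm x = 1}"
  then obtain x :: "complex^'n" where p: "p = (x, riesz x)" and x: "norm x = 1" by blast
  have "norm (riesz x) = 1"
    using norm_riesz_le[of x] norm_blinfun[of "riesz x" x] x by (simp add: riesz_self)
  then show "p \<in> complex_banach.norming_pairs (*s)"
    using p x riesz_in_dual[of x]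
    by (simp add: complex_banach.norming_pairs_def[OF complex_banach_vec] riesz_self)
qed

section \<open>Moduli and phases\<close>

definition sq_moduli :: "complex^'n \<Rightarrow> real^'n" where
  "sq_moduli x = (\<chi> j. (cmod (x $ j))\<^sup>2)"

text \<open>Since \<open>sgn 0 = 0\<close>, coordinates where \<open>x\<close> vanishes are assigned phase 1.\<close>

definition with_phases :: "complex^'n \<Rightarrow> real^'n \<Rightarrow> complex^'n" where
  "with_phases x a = (\<chi> j. of_real (sqrt (a $ j)) * (if x $ j = 0 then 1 else sgn (x $ j)))"

lemma sq_moduli_in_simplex:
  assumes "norm x = 1"
  shows "sq_moduli x \<in> std_simplex"
proof -
  have "(\<Sum>j\<in>UNIV. (cmod (x $ j))\<^sup>2) = 1"
    using assms power2_norm_vec[of x] by simp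
  moreover have "(cmod (x $ j))\<^sup>2 \<le> 1" for j
    using assms Finite_Cartesian_Product.norm_nth_le[of x j] by (intro power_le_one) auto
  ultimately show ?thesis
    by (simp add: std_simplex_def sq_moduli_def)
qed

text \<open>Every phase factor has modulus 1, also where \<open>x\<close> vanishes thanks to the
  default phase, so this holds on the whole simplex.\<close>

lemma sq_moduli_with_phases:
  assumes "a \<in> std_simplex"
  shows "sq_moduli (with_phases x a) = a"
  using assms
  by (auto simp: std_simplex_def sq_moduli_def with_phases_def vec_eq_iff norm_mult norm_sgn
      power_mult_distrib)

lemma norm_with_phases:
  assumes "a \<in> std_simplex"
  shows "norm (with_phases x a) = 1"
proof -
  have "(norm (with_phases x a))\<^sup>2 = (\<Sum>j\<in>UNIV. sq_moduli (with_phases x a) $ j)"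
    by (simp add: power2_norm_vec sq_moduli_def)
  also have "\<dots> = 1"
    using assms by (simp add: sq_moduli_with_phases) (simp add: std_simplex_def)
  finally show ?thesis by (simp add: power2_eq_1_iff) (smt (verit) norm_ge_zero)
qed

text \<open>The section of \<open>sq_moduli\<close> with the phases of \<open>x\<close> passes
  through \<open>x\<close> itself; at a zero coordinate the factor \<open>sqrt 0\<close> absorbs the
  default phase.\<close>

lemma with_phases_sq_moduli: "with_phases x (sq_moduli x) = x"
  by (simp add: with_phases_def sq_moduli_def vec_eq_iff sgn_div_norm scaleR_conv_of_real)

lemma continuous_on_sq_moduli: "continuous_on S sq_moduli"
  unfolding sq_moduli_def by (intro continuous_intros)

text \<open>The phases do not depend on the argument; only the square roots vary, and these are
  continuous at 0 too.\<close>

lemma continuous_on_with_phases: "continuous_on S (with_phases x)"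
  unfolding with_phases_def by (intro continuous_intros)

section \<open>Orbits\<close>

definition simplex_orbit_at :: "complex^'n \<Rightarrow> real^'n \<Rightarrow> nat \<Rightarrow> complex" where
  "simplex_orbit_at l a n = (\<Sum>j\<in>UNIV. of_real (a $ j) * (l $ j) ^ n)"

text \<open>Exponent 0 produces the adjoined point 1: since \<open>0 ^ 0 = 1\<close>, zero
  eigenvalues contribute their weight as well, and the weights sum to 1.\<close>

lemma simplex_orbit_eq_range:
  assumes "a \<in> std_simplex"
  shows "simplex_orbit l a = range (simplex_orbit_at l a)"
proof -
  have "simplex_orbit_at l a 0 = of_real (\<Sum>j\<in>UNIV. a $ j)"
    by (simp add: simplex_orbit_at_def)
  also have "\<dots> = 1"
    using assms by (simp add: std_simplex_def del: of_real_sum)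
  finally have "simplex_orbit_at l a 0 = 1" .
  moreover have "range (simplex_orbit_at l a) =
      insert (simplex_orbit_at l a 0) {simplex_orbit_at l a n | n. n \<ge> 1}"
    by (auto simp: image_def) (metis One_nat_def Suc_leI not_gr_zero)
  ultimately show ?thesis
    by (simp add: simplex_orbit_def simplex_orbit_at_def)
qed

lemma continuous_on_simplex_orbit_at: "continuous_on S (\<lambda>a. simplex_orbit_at l a n)"
  unfolding simplex_orbit_at_def by (intro continuous_intros)

lemma diag_power_nth: "(((*v) (diag l) ^^ n) x) $ i = l $ i ^ n * x $ i"
proof (induction n)
  case (Suc n)
  have "(diag l *v y) $ i = l $ i * y $ i" for y
    by (simp add: diag_def matrix_vector_mult_def if_distrib[of "\<lambda>c. c * _"] cong: if_cong)
  with Suc show ?case by (simp add: mult.assoc)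
qed simp

text \<open>The phases cancel coordinatewise in \<open>cnj (x $ j) * x $ j\<close>, leaving squared
  moduli as weights.\<close>

lemma riesz_diag_power:
  "riesz x (((*v) (diag l) ^^ n) x) = simplex_orbit_at l (sq_moduli x) n"
  by (simp add: riesz.rep_eq diag_power_nth simplex_orbit_at_def sq_moduli_def
      complex_norm_square mult_ac del: of_real_power)

lemma numerically_hypercyclic_diag_iff:
  "complex_banach.numerically_hypercyclic (*s) ((*v) (diag l)) \<longleftrightarrow> dense_orbit_params l \<noteq> {}"
proof -
  have "complex_banach.numerically_hypercyclic (*s) ((*v) (diag l)) \<longleftrightarrow>
      (\<exists>x. norm x = 1 \<and> closure (range (simplex_orbit_at l (sq_moduli x))) = UNIV)"
    unfolding complex_banach.numerically_hypercyclic_def[OF complex_banach_vec] norming_pairs_eq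
    by (auto simp: riesz_diag_power full_SetCompr_eq)
  also have "\<dots> \<longleftrightarrow> (\<exists>a\<in>std_simplex. closure (range (simplex_orbit_at l a)) = UNIV)"
    by (metis norm_with_phases sq_moduli_in_simplex sq_moduli_with_phases)
  also have "\<dots> \<longleftrightarrow> dense_orbit_params l \<noteq> {}"
    by (auto simp: dense_orbit_params_def simplex_orbit_eq_range)
  finally show ?thesis .
qed

lemma topologically_numerically_transitive_diag_iff:
  fixes l :: "complex^'n"
  shows "complex_banach.topologically_numerically_transitive (*s) ((*v) (diag l)) \<longleftrightarrow>
    (\<forall>W V. openin (top_of_set std_simplex) W \<and> W \<noteq> {} \<and> open V \<and> V \<noteq> {} \<longrightarrow>
      (\<exists>n. \<exists>a\<in>W. simplex_orbit_at l a n \<in> V))" (is "?T \<longleftrightarrow> ?S")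
proof
  let ?P = "complex_banach.norming_pairs (*s) :: ((complex^'n) \<times> ((complex^'n) \<Rightarrow>\<^sub>L complex)) set"
  assume T: ?T
  show ?S
  proof (intro allI impI, elim conjE)
    fix W :: "(real^'n) set" and V :: "complex set"
    assume W: "openin (top_of_set std_simplex) W" "W \<noteq> {}" and V: "open V" "V \<noteq> {}"
    let ?U = "?P \<inter> (\<lambda>p. sq_moduli (fst p)) -` W"
    have "openin (top_of_set ?P) ?U"
    proof (rule continuous_openin_preimage)
      show "continuous_on ?P (\<lambda>p. sq_moduli (fst p))"
        by (rule continuous_on_compose2[OF continuous_on_sq_moduli[of UNIV]])
          (auto intro: continuous_intros)
      show "(\<lambda>p. sq_moduli (fst p)) \<in> ?P \<rightarrow> std_simplex"
        by (auto simp: norming_pairs_eq sq_moduli_in_simplex)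
    qed (rule W)
    moreover have "?U \<noteq> {}"
    proof -
      obtain a where a: "a \<in> W" "a \<in> std_simplex"
        using W openin_imp_subset by blast
      \<comment> \<open>Any choice of phases would do; the vector 0 makes all of them 1.\<close>
      have "(with_phases 0 a, riesz (with_phases 0 a)) \<in> ?U"
        using a by (simp add: norming_pairs_eq norm_with_phases sq_moduli_with_phases)
      then show ?thesis by blast
    qed
    ultimately obtain n x f where "(x, f) \<in> ?U" "f (((*v) (diag l) ^^ n) x) \<in> V"
      using T V
      unfolding complex_banach.topologically_numerically_transitive_def[OF complex_banach_vec]
      by blast
    then show "\<exists>n. \<exists>a\<in>W. simplex_orbit_at l a n \<in> V"
      by (auto simp: norming_pairs_eq riesz_diag_power)
  qed
next
  let ?P = "complex_banach.norming_pairs (*s) :: ((complex^'n) \<times> ((complex^'n) \<Rightarrow>\<^sub>L complex)) set"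
  assume S: ?S
  show ?T
    unfolding complex_banach.topologically_numerically_transitive_def[OF complex_banach_vec]
  proof (intro allI impI, elim conjE)
    fix U and V :: "complex set"
    assume U: "openin (top_of_set ?P) U" "U \<noteq> {}" and V: "open V" "V \<noteq> {}"
    obtain x where x: "(x, riesz x) \<in> U" "norm x = 1"
      using U openin_imp_subset[OF U(1)] by (auto simp: norming_pairs_eq)
    \<comment> \<open>A continuous map from the simplex into the norming pairs, sending
      \<open>sq_moduli x\<close> back to the given pair \<open>(x, riesz x)\<close>.\<close>
    let ?g = "\<lambda>a. (with_phases x a, riesz (with_phases x a))"
    let ?W = "std_simplex \<inter> ?g -` U"
    have "openin (top_of_set std_simplex) ?W"
    proof (rule continuous_openin_preimage)
      show "continuous_on std_simplex ?g"
        by (intro continuous_on_Pair continuous_on_with_phases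
            continuous_on_compose2[OF continuous_on_riesz[of UNIV]]) simp
      show "?g \<in> std_simplex \<rightarrow> ?P"
        by (auto simp: norming_pairs_eq norm_with_phases)
    qed (rule U)
    moreover have "sq_moduli x \<in> ?W"
      using x by (simp add: sq_moduli_in_simplex with_phases_sq_moduli)
    ultimately obtain n a where a: "a \<in> ?W" "simplex_orbit_at l a n \<in> V"
      using S V by blast
    have "riesz (with_phases x a) (((*v) (diag l) ^^ n) (with_phases x a)) \<in> V"
      using a by (simp add: riesz_diag_power sq_moduli_with_phases)
    then show "\<exists>n. \<exists>(x, f)\<in>U. blinfun_apply f (((*v) (diag l) ^^ n) x) \<in> V"
      using a(1) by blast
  qed
qed

section \<open>Transitivity and density\<close>

lemma closed_std_simplex: "closed std_simplex"
proof -
  have "std_simplex = (\<Inter>j. {a :: real^'n. 0 \<le> a $ j} \<inter> {a. a $ j \<le> 1}) \<inter> {a. (\<Sum>j\<in>UNIV. a $ j) = 1}"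
    by (auto simp: std_simplex_def)
  also have "closed \<dots>"
    by (intro closed_Int closed_INT closed_Collect_le closed_Collect_eq ballI continuous_intros)
  finally show ?thesis .
qed

lemma closure_eq_UNIV_iff: "closure S = UNIV \<longleftrightarrow> (\<forall>V. open V \<and> V \<noteq> {} \<longrightarrow> S \<inter> V \<noteq> {})"
proof
  assume "closure S = UNIV"
  then show "\<forall>V. open V \<and> V \<noteq> {} \<longrightarrow> S \<inter> V \<noteq> {}"
    by (metis Int_UNIV_right Int_commute open_Int_closure_eq_empty)
next
  assume "\<forall>V. open V \<and> V \<noteq> {} \<longrightarrow> S \<inter> V \<noteq> {}"
  moreover have "S \<inter> - closure S = {}"
    using closure_subset[of S] by blast
  ultimately show "closure S = UNIV"
    using closed_closure[of S] by (auto simp: closed_def)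
qed

text \<open>Birkhoff's transitivity argument: the parameters with dense orbit contain a countable
  intersection of relatively open dense sets, one for each nonempty basic open set to be
  visited.\<close>

lemma simplex_transitive_iff:
  fixes l :: "complex^'n"
  shows "(\<forall>W V. openin (top_of_set std_simplex) W \<and> W \<noteq> {} \<and> open V \<and> V \<noteq> {} \<longrightarrow>
      (\<exists>n. \<exists>a\<in>W. simplex_orbit_at l a n \<in> V)) \<longleftrightarrow>
    std_simplex \<subseteq> closure (dense_orbit_params l)" (is "?S \<longleftrightarrow> ?C")
proof
  assume S: ?S
  obtain B :: "complex set set" where B: "countable B" "topological_basis B"
    using ex_countable_basis by blast
  define hit where "hit V = {a \<in> std_simplex. \<exists>n. simplex_orbit_at l a n \<in> V}" for V
  \<comment> \<open>The empty basic set is dropped because \<open>hit {}\<close> is empty, hence not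
    dense. Inserting \<open>std_simplex\<close> keeps the intersection inside the simplex.\<close>
  have "std_simplex \<subseteq> closure (\<Inter> (insert std_simplex (hit ` (B - {{}}))))"
  proof (rule Baire[OF closed_std_simplex])
    fix T assume "T \<in> insert std_simplex (hit ` (B - {{}}))"
    then consider "T = std_simplex" | V where "open V" "V \<noteq> {}" "T = hit V"
      using topological_basis_open[OF B(2)] by blast
    then show "openin (top_of_set std_simplex) T \<and> std_simplex \<subseteq> closure T"
    proof cases
      case 1
      then show ?thesis by (simp add: closure_subset)
    next
      case 2
      have hit: "hit V = (\<Union>n. std_simplex \<inter> (\<lambda>a. simplex_orbit_at l a n) -` V)"
        by (auto simp: hit_def)
      \<comment> \<open>Each orbit point depends continuously on \<open>a\<close>, so
        \<open>hit V\<close> is a union of relatively open preimages.\<close>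
      have op: "openin (top_of_set std_simplex) (hit V)"
        unfolding hit
        by (intro openin_Union) (use continuous_openin_preimage_gen
            [OF continuous_on_simplex_orbit_at 2(1)] in blast)
      have "a \<in> closure (hit V)" if a: "a \<in> std_simplex" for a
        unfolding closure_iff_nhds_not_empty
      proof (intro allI impI)
        fix A A' assume A: "A' \<subseteq> A" "a \<in> A'" "open A'"
        have "openin (top_of_set std_simplex) (std_simplex \<inter> A')"
          using A(3) by blast
        then obtain n b where "b \<in> std_simplex \<inter> A'" "simplex_orbit_at l b n \<in> V"
          using S[rule_format, of "std_simplex \<inter> A'" V] 2 a A(2) by blast
        then show "hit V \<inter> A \<noteq> {}"
          using A(1) by (auto simp: hit_def)
      qed
      then show ?thesis using op 2(3) by blast
    qed
  qed (use B(1) in simp)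
  moreover have "\<Inter> (insert std_simplex (hit ` (B - {{}}))) \<subseteq> dense_orbit_params l"
  proof
    fix a assume a: "a \<in> \<Inter> (insert std_simplex (hit ` (B - {{}})))"
    have "range (simplex_orbit_at l a) \<inter> V \<noteq> {}" if V: "open V" "V \<noteq> {}" for V
    proof -
      \<comment> \<open>The point \<open>z\<close> guarantees that the basic set \<open>V'\<close>
        is nonempty and so belongs to the family.\<close>
      obtain z where "z \<in> V" using V by blast
      then obtain V' where "V' \<in> B" "z \<in> V'" "V' \<subseteq> V"
        using topological_basisE[OF B(2) V(1)] by blast
      then have "a \<in> hit V'" using a by blast
      then show ?thesis using \<open>V' \<subseteq> V\<close> by (auto simp: hit_def)
    qed
    then have "closure (range (simplex_orbit_at l a)) = UNIV"
      by (auto simp: closure_eq_UNIV_iff)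
    then show "a \<in> dense_orbit_params l"
      using a by (simp add: dense_orbit_params_def simplex_orbit_eq_range)
  qed
  ultimately show ?C
    by (meson closure_mono subset_trans)
next
  assume C: ?C
  show ?S
  proof (intro allI impI, elim conjE)
    fix W :: "(real^'n) set" and V :: "complex set"
    assume W: "openin (top_of_set std_simplex) W" "W \<noteq> {}" and V: "open V" "V \<noteq> {}"
    \<comment> \<open>\<open>W\<close> is only relatively open; its ambient open set
      \<open>A\<close> is what the closure can be tested against.\<close>
    obtain A where A: "open A" "W = std_simplex \<inter> A"
      using W(1) by (auto simp: openin_open)
    have "dense_orbit_params l \<inter> A \<noteq> {}"
      using C W(2) A open_Int_closure_eq_empty[of A "dense_orbit_params l"] by blast
    then obtain a where a: "a \<in> dense_orbit_params l" "a \<in> W"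
      using A(2) by (auto simp: dense_orbit_params_def)
    then have "closure (range (simplex_orbit_at l a)) = UNIV"
      by (auto simp: dense_orbit_params_def simplex_orbit_eq_range)
    then show "\<exists>n. \<exists>a\<in>W. simplex_orbit_at l a n \<in> V"
      using V a(2) unfolding closure_eq_UNIV_iff by blast
  qed
qed

theorem theorem3p7:
  fixes l :: "complex^'n" and D :: "complex^'n \<Rightarrow> complex^'n"
  assumes "CARD('n) \<ge> 2"
    and "D = (*v) (diag l)"
  shows "(complex_banach.numerically_hypercyclic (*s) D \<longleftrightarrow> dense_orbit_params l \<noteq> {}) \<and>
    (complex_banach.topologically_numerically_transitive (*s) D \<longleftrightarrow>
       std_simplex \<subseteq> closure (dense_orbit_params l))"
  unfolding assms(2)
  by (simp add: numerically_hypercyclic_diag_iff topologically_numerically_transitive_diag_iff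
      simplex_transitive_iff)

end
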